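(* Let $n$ be a positive integer. Then $\sigma(n) = 2n - 1$ if and only if $$\frac{2n}{n + 1} \leq \frac{\sigma(n)}{n} < \frac{2n + 1}{n + 1}.$$
   Context: $\sigma(n)$ denotes the sum of all positive divisors of $n$. The quantity $\sigma(n)/n$ is called the abundancy index of $n$. A positive integer $n$ is called almost perfect if $\sigma(n) = 2n-1$. *)

theory Defs
  imports Complex_Main
begin

definition divisor_sigma :: "nat \<Rightarrow> nat" where
  "divisor_sigma n = (\<Sum>d | d dvd n. d)"

end

theory Submission
  imports Defs
begin

text \<open>
  Nothing about divisors is needed. After clearing denominators, the two inequalities say that
  \<open>s * (n + 1)\<close>, where \<open>s\<close> is the divisor sum, lies in the interval from \<open>2 n^2\<close> up to but excluding
  \<open>2 n^2 + n\<close>. Since \<open>(2 n - 1) * (n + 1) = 2 n^2 + n - 1\<close> and the interval is shorter than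
  \<open>n + 1\<close>, the only multiple of \<open>n + 1\<close> in it is the one with \<open>s = 2 n - 1\<close>.
\<close>

lemma eq_double_minus_one_iff:
  fixes s n :: int
  assumes "n > 0"
  shows "s = 2 * n - 1 \<longleftrightarrow> 2 * n * n \<le> s * (n + 1) \<and> s * (n + 1) < (2 * n + 1) * n"
proof
  assume "s = 2 * n - 1"
  then have "s * (n + 1) = 2 * n * n + n - 1"
    by (simp only:) (simp add: algebra_simps)
  \<comment> \<open>The lower bound is where \<open>n >= 1\<close> enters; the upper bound holds
    with a margin of exactly 1.\<close>
  then show "2 * n * n \<le> s * (n + 1) \<and> s * (n + 1) < (2 * n + 1) * n"
    using assms by (simp add: distrib_right)
next
  assume bounds: "2 * n * n \<le> s * (n + 1) \<and> s * (n + 1) < (2 * n + 1) * n"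
  have "\<not> s \<le> 2 * n - 2"
  proof
    assume "s \<le> 2 * n - 2"
    \<comment> \<open>The right side is \<open>2 * n * n - 2\<close>, just below the lower
      bound.\<close>
    then have "s * (n + 1) \<le> (2 * n - 2) * (n + 1)"
      using assms by (intro mult_right_mono) auto
    with bounds show False by (simp add: algebra_simps)
  qed
  moreover have "\<not> 2 * n \<le> s"
  proof
    assume "2 * n \<le> s"
    \<comment> \<open>The left side exceeds the upper bound by \<open>n\<close>.\<close>
    then have "2 * n * (n + 1) \<le> s * (n + 1)"
      using assms by (intro mult_right_mono) auto
    with bounds assms show False by (simp add: algebra_simps)
  qed
  ultimately show "s = 2 * n - 1" by linarith
qed

theorem theorem1:
  fixes n :: nat
  assumes "n > 0"
  shows "int (divisor_sigma n) = 2 * int n - 1 \<longleftrightarrow>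
    2 * real n / (real n + 1) \<le> real (divisor_sigma n) / real n \<and>
    real (divisor_sigma n) / real n < (2 * real n + 1) / (real n + 1)"
proof -
  define s where "s = divisor_sigma n"
  \<comment> \<open>Cross-multiplied sides are written as casts of integers, so that
    \<open>of_int_le_iff\<close> and \<open>of_int_less_iff\<close> carry the comparison from the
    reals to the integer lemma.\<close>
  have "2 * real n / (real n + 1) \<le> real s / real n \<longleftrightarrow>
      real_of_int (2 * int n * int n) \<le> real_of_int (int s * (int n + 1))"
    using assms by (simp add: divide_le_eq le_divide_eq field_simps)
  moreover have "real s / real n < (2 * real n + 1) / (real n + 1) \<longleftrightarrow>
      real_of_int (int s * (int n + 1)) < real_of_int ((2 * int n + 1) * int n)"
    using assms by (simp add: divide_less_eq less_divide_eq field_simps)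
  ultimately show ?thesis
    using eq_double_minus_one_iff[of "int n" "int s"] assms
    unfolding s_def[symmetric] of_int_le_iff of_int_less_iff by simp
qed

end
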